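(* Let $F$ be any field of characteristic $0$ and let $n\in\mathbb N$. Then every nonzero multilinear polynomial is surjective on the $n$th Weyl algebra $A_n(F)$; that is, for every $m\in\mathbb N$ and every nonzero multilinear $f\in F\langle X_1,\dots,X_m\rangle$, one has $f(A_n(F))=A_n(F)$.
   Context: $F\langle X_1,\dots,X_m\rangle$ is the free (associative unital) algebra over $F$. A polynomial $f\in F\langle X_1,\dots,X_m\rangle$ is multilinear if $f=\sum_{\sigma\in S_m}\lambda_\sigma X_{\sigma(1)}\cdots X_{\sigma(m)}$ for some $\lambda_\sigma\in F$. For an $F$-algebra $A$, $f(A)=\{f(a_1,\dots,a_m)\mid a_1,\dots,a_m\in A\}$, and $f$ is surjective on $A$ if $f(A)=A$. The $n$th Weyl algebra $A_n(F)$ is the unital $F$-algebra generated by $p_1,\dots,p_n,q_1,\dots,q_n$ subject to the relations $[p_i,q_j]=\delta_{ij}$, $[p_i,p_j]=[q_i,q_j]=0$, where $[x,y]=xy-yx$. *)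

theory Defs
  imports Complex_Main "HOL-Library.Poly_Mapping" "HOL-Combinatorics.Permutations"
begin

section \<open>Free associative unital algebras\<close>

text \<open>The library's finitely supported functions carry the convolution product as soon as the index
  type is a (possibly non-commutative, additively written) monoid. Words are wrapped in their own type
  in order not to impose a monoid structure on all lists.\<close>

datatype 'x nc_word = Nc_Word (letters: "'x list")

instantiation nc_word :: (type) monoid_add
begin
definition zero_nc_word :: "'a nc_word" where "0 = Nc_Word []"
definition plus_nc_word :: "'a nc_word \<Rightarrow> 'a nc_word \<Rightarrow> 'a nc_word"
  where "v + w = Nc_Word (letters v @ letters w)"
instance by standard (simp_all add: zero_nc_word_def plus_nc_word_def)
end

lemma letters_zero [simp]: "letters 0 = []"
  and letters_plus [simp]: "letters (v + w) = letters v @ letters w"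
  by (simp_all add: zero_nc_word_def plus_nc_word_def)

type_synonym ('x, 'f) free_algebra = "'x nc_word \<Rightarrow>\<^sub>0 'f"

definition fvar :: "'x \<Rightarrow> ('x, 'f::field) free_algebra"
  where "fvar x = Poly_Mapping.single (Nc_Word [x]) 1"

definition fscale :: "'f::field \<Rightarrow> ('x, 'f) free_algebra \<Rightarrow> ('x, 'f) free_algebra"
  where "fscale c f = Poly_Mapping.single 0 c * f"

section \<open>Algebras over a field, evaluation of polynomials, images\<close>

locale unital_algebra = vector_space scale
  for scale :: "'f::field \<Rightarrow> 'a::ring_1 \<Rightarrow> 'a" +
  assumes scale_mult_left: "scale c x * y = scale c (x * y)"
    and scale_mult_right: "x * scale c y = scale c (x * y)"

definition poly_eval :: "('f::field \<Rightarrow> 'a::ring_1 \<Rightarrow> 'a) \<Rightarrow> ('x \<Rightarrow> 'a) \<Rightarrow> ('x, 'f) free_algebra \<Rightarrow> 'a"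
  where "poly_eval scale a f =
    (\<Sum>w\<in>Poly_Mapping.keys f. scale (Poly_Mapping.lookup f w) (prod_list (map a (letters w))))"

text \<open>A polynomial in the indeterminates X 1, ..., X m is an element of the free algebra on countably
  many indeterminates in which only these occur. Assignments are total functions on the
  indeterminates; values at indices outside 1, ..., m do not affect the evaluation.\<close>

definition poly_image :: "('f::field \<Rightarrow> 'a::ring_1 \<Rightarrow> 'a) \<Rightarrow> (nat, 'f) free_algebra \<Rightarrow> 'a set"
  where "poly_image scale f = {poly_eval scale a f | a. True}"

definition multilinear :: "nat \<Rightarrow> (nat, 'f::field) free_algebra \<Rightarrow> bool"
  where "multilinear m f \<longleftrightarrow> (\<exists>c :: (nat \<Rightarrow> nat) \<Rightarrow> 'f.
    f = (\<Sum>s | s permutes {1..m}. fscale (c s) (prod_list (map (\<lambda>i. fvar (s i)) [1..<Suc m]))))"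

section \<open>Weyl algebras\<close>

datatype 'n weyl_gen = Gen_p 'n | Gen_q 'n

inductive_set two_sided_ideal :: "'a::ring_1 set \<Rightarrow> 'a set" for R where
  zero: "0 \<in> two_sided_ideal R"
| generator: "r \<in> R \<Longrightarrow> r \<in> two_sided_ideal R"
| add: "x \<in> two_sided_ideal R \<Longrightarrow> y \<in> two_sided_ideal R \<Longrightarrow> x + y \<in> two_sided_ideal R"
| mult_left: "x \<in> two_sided_ideal R \<Longrightarrow> a * x \<in> two_sided_ideal R"
| mult_right: "x \<in> two_sided_ideal R \<Longrightarrow> x * a \<in> two_sided_ideal R"

definition commutator :: "'a::ring_1 \<Rightarrow> 'a \<Rightarrow> 'a"
  where "commutator x y = x * y - y * x"

definition weyl_relators :: "('n weyl_gen, 'f::field) free_algebra set"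
  where "weyl_relators =
    {commutator (fvar (Gen_p i)) (fvar (Gen_q j)) - (if i = j then 1 else 0) | i j. True}
    \<union> {commutator (fvar (Gen_p i)) (fvar (Gen_p j)) | i j. True}
    \<union> {commutator (fvar (Gen_q i)) (fvar (Gen_q j)) | i j. True}"

lemma two_sided_ideal_uminus: "x \<in> two_sided_ideal R \<Longrightarrow> - x \<in> two_sided_ideal R"
  using two_sided_ideal.mult_left[of x R "-1"] by simp

lemma two_sided_ideal_diff:
  "x \<in> two_sided_ideal R \<Longrightarrow> y \<in> two_sided_ideal R \<Longrightarrow> x - y \<in> two_sided_ideal R"
  using two_sided_ideal.add[of x R "- y"] two_sided_ideal_uminus[of y R] by simp

lemma two_sided_ideal_refl: "x = y \<Longrightarrow> x - y \<in> two_sided_ideal R"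
  by (simp add: two_sided_ideal.zero)

text \<open>The n-th Weyl algebra is the algebra of this type with n the cardinality of the finite
  (automatically nonempty) type of indices.\<close>

quotient_type (overloaded) ('n, 'f) weyl = "('n weyl_gen, 'f::field) free_algebra" /
  "\<lambda>f g. f - g \<in> two_sided_ideal weyl_relators"
proof (rule equivpI)
  let ?I = "two_sided_ideal (weyl_relators :: ('n weyl_gen, 'f) free_algebra set)"
  show "reflp (\<lambda>f g. f - g \<in> ?I)"
    by (rule reflpI) (simp add: two_sided_ideal.zero)
  show "symp (\<lambda>f g. f - g \<in> ?I)"
    by (rule sympI) (drule two_sided_ideal_uminus, simp)
  show "transp (\<lambda>f g. f - g \<in> ?I)"
    by (rule transpI) (drule (1) two_sided_ideal.add, simp)
qed

text \<open>The class of rings with unit demands that 0 and 1 differ, so the quotient has to be shown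
  nontrivial first. This is done by letting the free algebra act on formal power series (given by
  their coefficients): q i acts by multiplication by the i-th variable, p i by differentiation.\<close>

fun gen_act :: "'n weyl_gen \<Rightarrow> (('n \<Rightarrow> nat) \<Rightarrow> 'f::field) \<Rightarrow> (('n \<Rightarrow> nat) \<Rightarrow> 'f)" where
  "gen_act (Gen_p i) v k = of_nat (Suc (k i)) * v (k(i := Suc (k i)))"
| "gen_act (Gen_q i) v k = (if k i = 0 then 0 else v (k(i := k i - 1)))"

definition word_act :: "'n weyl_gen nc_word \<Rightarrow> (('n \<Rightarrow> nat) \<Rightarrow> 'f::field) \<Rightarrow> (('n \<Rightarrow> nat) \<Rightarrow> 'f)"
  where "word_act w = foldr gen_act (letters w)"

definition free_act ::
  "('n weyl_gen, 'f) free_algebra \<Rightarrow> (('n \<Rightarrow> nat) \<Rightarrow> 'f::field) \<Rightarrow> (('n \<Rightarrow> nat) \<Rightarrow> 'f)"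
  where "free_act f v k = (\<Sum>w\<in>Poly_Mapping.keys f. Poly_Mapping.lookup f w * word_act w v k)"

lemma gen_act_add: "gen_act g (\<lambda>k. u k + v k) = (\<lambda>k. gen_act g u k + gen_act g v k)"
  by (cases g) (auto simp: fun_eq_iff algebra_simps)

lemma gen_act_cmult: "gen_act g (\<lambda>k. c * v k) = (\<lambda>k. c * gen_act g v k)"
  by (cases g) (auto simp: fun_eq_iff algebra_simps)

lemma word_act_zero: "word_act 0 v = v"
  by (simp add: word_act_def)

lemma word_act_plus: "word_act (v + w) u = word_act v (word_act w u)"
  by (simp add: word_act_def)

lemma word_act_add: "word_act w (\<lambda>k. u k + v k) = (\<lambda>k. word_act w u k + word_act w v k)"
proof -
  have "foldr gen_act xs (\<lambda>k. u k + v k) = (\<lambda>k. foldr gen_act xs u k + foldr gen_act xs v k)" for xs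
    by (induction xs) (simp_all add: gen_act_add)
  then show ?thesis by (simp add: word_act_def)
qed

lemma word_act_cmult: "word_act w (\<lambda>k. c * v k) = (\<lambda>k. c * word_act w v k)"
proof -
  have "foldr gen_act xs (\<lambda>k. c * v k) = (\<lambda>k. c * foldr gen_act xs v k)" for xs
    by (induction xs) (simp_all add: gen_act_cmult)
  then show ?thesis by (simp add: word_act_def)
qed

lemma word_act_null: "word_act w (\<lambda>k. 0 :: 'f::field) = (\<lambda>k. 0)"
  using word_act_cmult[of w "0 :: 'f" "\<lambda>k. 0"] by simp

lemma free_act_superset:
  assumes "finite S" "Poly_Mapping.keys f \<subseteq> S"
  shows "free_act f v k = (\<Sum>w\<in>S. Poly_Mapping.lookup f w * word_act w v k)"
  unfolding free_act_def
  by (rule sum.mono_neutral_left) (use assms in \<open>auto simp: in_keys_iff\<close>)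

lemma free_act_plus: "free_act (f + g) v = (\<lambda>k. free_act f v k + free_act g v k)"
proof
  fix k
  let ?S = "Poly_Mapping.keys f \<union> Poly_Mapping.keys g"
  have S: "finite ?S" "Poly_Mapping.keys (f + g) \<subseteq> ?S" "Poly_Mapping.keys f \<subseteq> ?S"
    "Poly_Mapping.keys g \<subseteq> ?S"
    by (auto dest: keys_add[THEN subsetD])
  show "free_act (f + g) v k = free_act f v k + free_act g v k"
    unfolding free_act_superset[OF S(1,2)] free_act_superset[OF S(1,3)] free_act_superset[OF S(1,4)]
    by (simp add: lookup_add algebra_simps sum.distrib)
qed

lemma free_act_single: "free_act (Poly_Mapping.single w c) v = (\<lambda>k. c * word_act w v k)"
  by (cases "c = 0") (auto simp: free_act_def fun_eq_iff)

lemma free_act_zero: "free_act 0 v = (\<lambda>k. 0)"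
  by (simp add: free_act_def fun_eq_iff)

lemma free_act_one: "free_act 1 v = v"
  using free_act_single[of 0 1 v] by (simp add: word_act_zero)

lemma free_algebra_induct [case_names zero single_plus]:
  fixes f :: "'w \<Rightarrow>\<^sub>0 'b::ab_group_add"
  assumes "P 0" "\<And>w c f. P f \<Longrightarrow> P (Poly_Mapping.single w c + f)"
  shows "P f"
proof (induction f rule: update_induct)
  case const
  then show ?case by (rule assms(1))
next
  case (update f a b)
  have "Poly_Mapping.update a b f = Poly_Mapping.single a b + f"
    using update(1)
    by (intro poly_mapping_eqI) (auto simp: lookup_update lookup_add lookup_single in_keys_iff when_def)
  then show ?case using assms(2) update by simp
qed

lemma word_act_free_act:
  "free_act (Poly_Mapping.single w c * f) v = (\<lambda>k. c * word_act w (free_act f v) k)"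
proof (induction f rule: free_algebra_induct)
  case zero
  show ?case by (simp add: free_act_zero word_act_null)
next
  case (single_plus w' c' f)
  then show ?case
    by (simp add: distrib_left free_act_plus mult_single free_act_single word_act_plus word_act_add
        word_act_cmult algebra_simps)
qed

lemma free_act_times: "free_act (f * g) v = free_act f (free_act g v)"
proof (induction f rule: free_algebra_induct)
  case zero
  show ?case by (simp add: free_act_zero)
next
  case (single_plus w c f)
  then show ?case
    by (simp add: distrib_right free_act_plus free_act_single word_act_free_act)
qed

lemma free_act_diff: "free_act (f - g) v = (\<lambda>k. free_act f v k - free_act g v k)"
  using free_act_plus[of "f - g" g v] by (simp add: fun_eq_iff)

lemma free_act_fvar: "free_act (fvar x) v = gen_act x v"
  by (simp add: fvar_def free_act_single word_act_def)

lemma free_act_relator: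
  assumes "r \<in> (weyl_relators :: ('n weyl_gen, 'f::field) free_algebra set)"
  shows "free_act r v = (\<lambda>k. 0)"
proof
  fix k
  have pq: "free_act (commutator (fvar (Gen_p i)) (fvar (Gen_q j)) - (if i = j then 1 else 0)) v k = 0"
    for i j
    by (cases "i = j")
      (auto simp: commutator_def free_act_diff free_act_times free_act_fvar free_act_one
        free_act_zero fun_upd_twist diff_add_eq distrib_left distrib_right)
  have pp: "free_act (commutator (fvar (Gen_p i)) (fvar (Gen_p j))) v k = 0" for i j
    by (cases "i = j")
      (auto simp: commutator_def free_act_diff free_act_times free_act_fvar free_act_zero fun_upd_twist)
  have qq: "free_act (commutator (fvar (Gen_q i)) (fvar (Gen_q j))) v k = 0" for i j
    by (cases "i = j")
      (auto simp: commutator_def free_act_diff free_act_times free_act_fvar free_act_zero fun_upd_twist)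
  show "free_act r v k = 0"
    using assms unfolding weyl_relators_def by (auto simp: pq pp qq simp del: minus_apply)
qed

lemma free_act_ideal:
  assumes "x \<in> two_sided_ideal (weyl_relators :: ('n weyl_gen, 'f::field) free_algebra set)"
  shows "free_act x v = (\<lambda>k. 0)"
  using assms
proof (induction arbitrary: v)
  case (mult_left x a)
  have "free_act a (\<lambda>k. 0 :: 'f) = (\<lambda>k. 0)"
    by (simp add: free_act_def fun_eq_iff word_act_null)
  then show ?case using mult_left by (simp add: free_act_times)
qed (simp_all add: free_act_zero free_act_relator free_act_plus free_act_times)

lemma one_notin_weyl_ideal: "1 \<notin> two_sided_ideal (weyl_relators :: ('n weyl_gen, 'f::field) free_algebra set)"
proof
  assume "1 \<in> two_sided_ideal (weyl_relators :: ('n weyl_gen, 'f) free_algebra set)"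
  from free_act_ideal[OF this, of "\<lambda>k. 1"] show False
    by (simp add: free_act_one fun_eq_iff)
qed

instantiation weyl :: (type, field) ring_1
begin

lift_definition zero_weyl :: "('a, 'b) weyl" is 0 .
lift_definition one_weyl :: "('a, 'b) weyl" is 1 .
lift_definition plus_weyl :: "('a, 'b) weyl \<Rightarrow> ('a, 'b) weyl \<Rightarrow> ('a, 'b) weyl" is "(+)"
  by (drule (1) two_sided_ideal.add) (simp add: algebra_simps)
lift_definition uminus_weyl :: "('a, 'b) weyl \<Rightarrow> ('a, 'b) weyl" is uminus
  by (drule two_sided_ideal_uminus) simp
lift_definition minus_weyl :: "('a, 'b) weyl \<Rightarrow> ('a, 'b) weyl \<Rightarrow> ('a, 'b) weyl" is "(-)"
proof -
  fix a b c d :: "('a weyl_gen, 'b) free_algebra"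
  assume "a - b \<in> two_sided_ideal weyl_relators" "c - d \<in> two_sided_ideal weyl_relators"
  from two_sided_ideal_diff[OF this] show "a - c - (b - d) \<in> two_sided_ideal weyl_relators"
    by (simp add: algebra_simps)
qed
lift_definition times_weyl :: "('a, 'b) weyl \<Rightarrow> ('a, 'b) weyl \<Rightarrow> ('a, 'b) weyl" is "(*)"
proof -
  fix a b c d :: "('a weyl_gen, 'b) free_algebra"
  assume "a - b \<in> two_sided_ideal weyl_relators" "c - d \<in> two_sided_ideal weyl_relators"
  then have "(a - b) * c + b * (c - d) \<in> two_sided_ideal weyl_relators"
    by (intro two_sided_ideal.add two_sided_ideal.mult_left two_sided_ideal.mult_right)
  then show "a * c - b * d \<in> two_sided_ideal weyl_relators"
    by (simp add: algebra_simps)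
qed

instance
proof
  show "(0 :: ('a, 'b) weyl) \<noteq> 1"
    using one_notin_weyl_ideal two_sided_ideal_uminus[of "- 1"]
    by (auto simp: zero_weyl.abs_eq one_weyl.abs_eq weyl.abs_eq_iff)
qed (transfer, rule two_sided_ideal_refl, simp add: algebra_simps)+

end

lift_definition weyl_scale :: "'f::field \<Rightarrow> ('n, 'f) weyl \<Rightarrow> ('n, 'f) weyl" is fscale
  by (simp add: fscale_def two_sided_ideal.mult_left flip: right_diff_distrib)

lift_definition weyl_p :: "'n \<Rightarrow> ('n, 'f::field) weyl" is "\<lambda>i. fvar (Gen_p i)" .
lift_definition weyl_q :: "'n \<Rightarrow> ('n, 'f::field) weyl" is "\<lambda>i. fvar (Gen_q i)" .

lemma weyl_relations:
  fixes i j :: 'n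
  shows "commutator (weyl_p i :: ('n, 'f::field) weyl) (weyl_q j) = (if i = j then 1 else 0)"
    and "commutator (weyl_p i :: ('n, 'f::field) weyl) (weyl_p j) = 0"
    and "commutator (weyl_q i :: ('n, 'f::field) weyl) (weyl_q j) = 0"
proof -
  let ?R = "weyl_relators :: ('n weyl_gen, 'f) free_algebra set"
  note abs = weyl_p.abs_eq weyl_q.abs_eq times_weyl.abs_eq minus_weyl.abs_eq one_weyl.abs_eq
    zero_weyl.abs_eq weyl.abs_eq_iff
  have "commutator (fvar (Gen_p i)) (fvar (Gen_q j)) - (if i = j then 1 else 0) \<in> ?R"
    unfolding weyl_relators_def
    by (rule UnI1, rule UnI1) (rule CollectI, rule exI[of _ i], rule exI[of _ j], simp)
  from two_sided_ideal.generator[OF this]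
  show "commutator (weyl_p i :: ('n, 'f) weyl) (weyl_q j) = (if i = j then 1 else 0)"
    unfolding commutator_def by (cases "i = j") (simp_all add: abs)
  have "commutator (fvar (Gen_p i)) (fvar (Gen_p j)) \<in> ?R"
    unfolding weyl_relators_def by (rule UnI1, rule UnI2) (rule CollectI, rule exI[of _ i], rule exI[of _ j], simp)
  from two_sided_ideal.generator[OF this]
  show "commutator (weyl_p i :: ('n, 'f) weyl) (weyl_p j) = 0"
    unfolding commutator_def by (simp add: abs)
  have "commutator (fvar (Gen_q i)) (fvar (Gen_q j)) \<in> ?R"
    unfolding weyl_relators_def by (rule UnI2) (rule CollectI, rule exI[of _ i], rule exI[of _ j], simp)
  from two_sided_ideal.generator[OF this]
  show "commutator (weyl_q i :: ('n, 'f) weyl) (weyl_q j) = 0"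
    unfolding commutator_def by (simp add: abs)
qed

lemma fscale_simps:
  "fscale a (x + y) = fscale a x + fscale a y"
  "fscale (a + b) x = fscale a x + fscale b x"
  "fscale a (fscale b x) = fscale (a * b) x"
  "fscale 1 x = x"
  "fscale a x * y = fscale a (x * y)"
  by (simp_all add: fscale_def distrib_left distrib_right single_add mult_single mult.assoc[symmetric])

lemma fscale_mult_right: "x * fscale c y = fscale c (x * y)"
proof -
  have "x * Poly_Mapping.single 0 c = Poly_Mapping.single 0 c * x"
    by (induction x rule: free_algebra_induct)
      (simp_all add: distrib_left distrib_right mult_single mult.commute)
  then show ?thesis by (simp add: fscale_def flip: mult.assoc)
qed

interpretation weyl: unital_algebra "weyl_scale :: 'f::field \<Rightarrow> ('n, 'f) weyl \<Rightarrow> ('n, 'f) weyl"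
  by standard (transfer, rule two_sided_ideal_refl, simp add: fscale_simps fscale_mult_right)+

end

theory Submission
  imports Defs
begin

text \<open>Let \<open>d = [x, \<cdot>]\<close> be a surjective inner derivation of a unital algebra. More generally than a
  multilinear polynomial, consider a nonzero form \<open>f\<close> that is multilinear in the derivatives
  \<open>d\<^sup>e a\<^sub>v\<close> and homogeneous in the total number of derivations. Let \<open>e\<close> be the
  least order in which a variable \<open>v\<close> occurs, and choose \<open>a\<^sub>v\<close> with
  \<open>d\<^sup>e a\<^sub>v = x\<^sup>s\<close>; this kills all terms of higher order in \<open>v\<close>. As
  \<open>u x\<^sup>s\<close> is a combination of the \<open>x\<^sup>s\<^sup>-\<^sup>i d\<^sup>i(u)\<close>, for
  the least \<open>s\<close> at which something survives the value of \<open>f\<close> is a nonzero form of the same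
  kind in one variable less. What remains in the end is \<open>c d\<^sup>k a\<close> with \<open>c \<noteq> 0\<close>, which is
  surjective in \<open>a\<close>. In the Weyl algebra \<open>d = [p\<^sub>i, \<cdot>]\<close> is surjective, because
  every element is a sum of terms \<open>q\<^sub>i\<^sup>k c\<close> with \<open>[p\<^sub>i, c] = 0\<close>, and
  \<open>d(q\<^sub>i\<^sup>k\<^sup>+\<^sup>1 c) = (k + 1) q\<^sub>i\<^sup>k c\<close>.\<close>

section \<open>Inner derivations, and evaluation as an algebra homomorphism\<close>

lemma commutator_add_right: "commutator x (y + z) = commutator x y + commutator x z"
  by (simp add: commutator_def algebra_simps)

lemma commutator_zero_right: "commutator x 0 = 0"
  by (simp add: commutator_def)

lemma commutator_mult_right: "commutator x (y * z) = commutator x y * z + y * commutator x z"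
  by (simp add: commutator_def algebra_simps)

lemma commutator_one_right: "commutator x 1 = 0"
  by (simp add: commutator_def)

lemma commutator_sum_right: "commutator x (sum g S) = (\<Sum>i\<in>S. commutator x (g i))"
  by (simp add: commutator_def sum_distrib_left sum_distrib_right sum_subtractf)

lemma funpow_commutator_zero: "(commutator x ^^ n) 0 = 0"
  by (induction n) (simp_all add: commutator_zero_right)

lemma surj_funpow: "surj g \<Longrightarrow> surj (g ^^ n)" for g :: "'a \<Rightarrow> 'a"
proof (induction n)
  case (Suc n)
  have "surj (g \<circ> g ^^ n)"
    using Suc by (intro comp_surj) auto
  then show ?case by simp
qed simp

context unital_algebra
begin

lemma commutator_scale_right: "commutator x (scale c y) = scale c (commutator x y)"
  by (simp add: commutator_def scale_mult_left scale_mult_right scale_right_diff_distrib)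

lemma poly_eval_superset:
  assumes "finite S" "Poly_Mapping.keys f \<subseteq> S"
  shows "poly_eval scale a f
    = (\<Sum>w\<in>S. scale (Poly_Mapping.lookup f w) (prod_list (map a (letters w))))"
  unfolding poly_eval_def
  by (rule sum.mono_neutral_left) (use assms in \<open>auto simp: in_keys_iff\<close>)

lemma poly_eval_zero: "poly_eval scale a 0 = 0"
  by (simp add: poly_eval_def)

lemma poly_eval_add: "poly_eval scale a (f + g) = poly_eval scale a f + poly_eval scale a g"
proof -
  let ?S = "Poly_Mapping.keys f \<union> Poly_Mapping.keys g"
  have S: "finite ?S" "Poly_Mapping.keys (f + g) \<subseteq> ?S" "Poly_Mapping.keys f \<subseteq> ?S"
    "Poly_Mapping.keys g \<subseteq> ?S"
    by (auto dest: keys_add[THEN subsetD])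
  show ?thesis
    unfolding poly_eval_superset[OF S(1,2)] poly_eval_superset[OF S(1,3)]
      poly_eval_superset[OF S(1,4)]
    by (simp add: lookup_add scale_left_distrib sum.distrib)
qed

lemma poly_eval_sum: "poly_eval scale a (sum g S) = (\<Sum>i\<in>S. poly_eval scale a (g i))"
  by (induction S rule: infinite_finite_induct) (simp_all add: poly_eval_zero poly_eval_add)

lemma poly_eval_single:
  "poly_eval scale a (Poly_Mapping.single w c) = scale c (prod_list (map a (letters w)))"
  by (cases "c = 0") (simp_all add: poly_eval_def)

lemma poly_eval_single_times:
  "poly_eval scale a (Poly_Mapping.single w c * f)
    = scale c (prod_list (map a (letters w)) * poly_eval scale a f)"
proof (induction f rule: free_algebra_induct)
  case (single_plus w' c' f)
  then show ?case
    by (simp add: distrib_left poly_eval_add mult_single poly_eval_single scale_right_distrib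
        scale_mult_right)
qed (simp add: poly_eval_zero)

lemma poly_eval_times: "poly_eval scale a (f * g) = poly_eval scale a f * poly_eval scale a g"
  by (induction f rule: free_algebra_induct)
    (simp_all add: poly_eval_zero distrib_right poly_eval_add poly_eval_single_times
      poly_eval_single scale_mult_left)

lemma poly_eval_fscale: "poly_eval scale a (fscale c f) = scale c (poly_eval scale a f)"
  by (simp add: fscale_def poly_eval_single_times)

end

section \<open>Coefficients and supports in free algebras\<close>

lemma lookup_fscale: "Poly_Mapping.lookup (fscale c f) w = c * Poly_Mapping.lookup f w"
  by (induction f rule: free_algebra_induct)
    (simp_all add: fscale_def distrib_left mult_single lookup_add lookup_single when_def)

lemma keys_fscale: "Poly_Mapping.keys (fscale c f) \<subseteq> Poly_Mapping.keys f"
  by (auto simp: in_keys_iff lookup_fscale)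

text \<open>A common suffix cancels in the free monoid, so right multiplication by a word only
  relabels coefficients.\<close>

lemma lookup_times_single_append:
  fixes f :: "('x, 'f::field) free_algebra"
  shows "Poly_Mapping.lookup (f * Poly_Mapping.single (Nc_Word v) 1) (Nc_Word (u @ v))
    = Poly_Mapping.lookup f (Nc_Word u)"
proof (induction f rule: free_algebra_induct)
  case (single_plus w c f)
  then show ?case
    by (cases w) (simp add: distrib_right mult_single lookup_add lookup_single plus_nc_word_def when_def)
qed simp

lemma keys_times_singleE:
  fixes f :: "('x, 'f::field) free_algebra"
  assumes "w \<in> Poly_Mapping.keys (f * Poly_Mapping.single (Nc_Word v) 1)"
  obtains u where "Nc_Word u \<in> Poly_Mapping.keys f" "w = Nc_Word (u @ v)"
proof -
  obtain w' where "w' \<in> Poly_Mapping.keys f" "w = w' + Nc_Word v"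
    using keys_mult[of f "Poly_Mapping.single (Nc_Word v) 1"] assms by auto
  then show ?thesis
    by (intro that[of "letters w'"]) (simp_all add: plus_nc_word_def)
qed

section \<open>Differential polynomials\<close>

text \<open>The letter \<open>(v, e)\<close> stands for the \<open>e\<close>-th derivative of the indeterminate \<open>v\<close>.\<close>

type_synonym ('x, 'f) diff_poly = "('x \<times> nat, 'f) free_algebra"

definition raise_at :: "nat \<Rightarrow> ('x \<times> nat) list \<Rightarrow> ('x \<times> nat) list"
  where "raise_at j u = u[j := (fst (u ! j), Suc (snd (u ! j)))]"

text \<open>The Leibniz rule in the free differential algebra; \<open>deriv_poly\<close> is its
  linear extension.\<close>

definition deriv_word :: "('x \<times> nat) list \<Rightarrow> ('x, 'f::field) diff_poly"
  where "deriv_word u = (\<Sum>j<length u. Poly_Mapping.single (Nc_Word (raise_at j u)) 1)"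

definition deriv_poly :: "('x, 'f::field) diff_poly \<Rightarrow> ('x, 'f) diff_poly"
  where "deriv_poly f =
    (\<Sum>w\<in>Poly_Mapping.keys f. fscale (Poly_Mapping.lookup f w) (deriv_word (letters w)))"

definition total_order :: "('x \<times> nat) list \<Rightarrow> nat"
  where "total_order u = sum_list (map snd u)"

text \<open>Differentiation keeps the variables in place and only raises orders. This partial order
  records which words can arise from which.\<close>

definition le_word :: "('x \<times> nat) list \<Rightarrow> ('x \<times> nat) list \<Rightarrow> bool"
  where "le_word = list_all2 (\<lambda>l l'. fst l = fst l' \<and> snd l \<le> snd l')"

lemma le_word_refl: "le_word u u"
  by (simp add: le_word_def list.rel_refl)

lemma le_word_trans: "le_word u v \<Longrightarrow> le_word v w \<Longrightarrow> le_word u w"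
  unfolding le_word_def by (rule list_all2_trans) auto

lemma le_word_map_fst: "le_word u v \<Longrightarrow> map fst u = map fst v"
  unfolding le_word_def by (induction rule: list_all2_induct) auto

lemma le_word_length: "le_word u v \<Longrightarrow> length u = length v"
  unfolding le_word_def by (rule list_all2_lengthD)

lemma le_word_append: "length u = length u' \<Longrightarrow> le_word (u @ v) (u' @ v') \<longleftrightarrow> le_word u u' \<and> le_word v v'"
  by (simp add: le_word_def list_all2_append)

lemma le_word_total_order: "le_word u v \<Longrightarrow> total_order u \<le> total_order v"
  unfolding le_word_def total_order_def by (induction rule: list_all2_induct) auto

text \<open>The orders compare letter by letter, so the sums can agree only if no letter was
  raised.\<close>

lemma le_word_antisym: "le_word u v \<Longrightarrow> total_order v \<le> total_order u \<Longrightarrow> u = v"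
  unfolding le_word_def
proof (induction rule: list_all2_induct)
  case (Cons x xs y ys)
  then have "total_order xs \<le> total_order ys"
    by (intro le_word_total_order) (simp add: le_word_def)
  with Cons show ?case
    by (auto simp: total_order_def prod_eq_iff)
qed simp

lemma le_word_raise_at: "le_word u (raise_at j u)"
proof -
  have "fst (u ! i) = fst (raise_at j u ! i) \<and> snd (u ! i) \<le> snd (raise_at j u ! i)"
    if "i < length u" for i
    using that by (cases "i = j") (simp_all add: raise_at_def)
  then show ?thesis
    by (simp add: le_word_def list_all2_conv_all_nth) (simp add: raise_at_def)
qed

lemma total_order_raise_at: "j < length u \<Longrightarrow> total_order (raise_at j u) = Suc (total_order u)"
  by (induction u arbitrary: j) (auto simp: total_order_def raise_at_def less_Suc_eq_0_disj)

lemma keys_deriv_wordE: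
  assumes "w \<in> Poly_Mapping.keys (deriv_word u :: ('x, 'f::field) diff_poly)"
  obtains j where "j < length u" "w = Nc_Word (raise_at j u)"
proof -
  have "w \<in> (\<Union>j<length u. Poly_Mapping.keys
      (Poly_Mapping.single (Nc_Word (raise_at j u)) (1 :: 'f)))"
    using assms unfolding deriv_word_def by (rule keys_sum[THEN subsetD])
  then show ?thesis using that by auto
qed

lemma lookup_deriv_poly:
  "Poly_Mapping.lookup (deriv_poly f) r = (\<Sum>w\<in>Poly_Mapping.keys f.
    Poly_Mapping.lookup f w * Poly_Mapping.lookup (deriv_word (letters w)) r)"
  by (simp add: deriv_poly_def lookup_sum lookup_fscale)

lemma keys_deriv_polyE:
  fixes f :: "('x, 'f::field) diff_poly"
  assumes "r \<in> Poly_Mapping.keys (deriv_poly f)"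
  obtains w where "w \<in> Poly_Mapping.keys f" "r \<in> Poly_Mapping.keys (deriv_word (letters w) :: ('x, 'f) diff_poly)"
proof -
  have "\<exists>w\<in>Poly_Mapping.keys f. Poly_Mapping.lookup (deriv_word (letters w)) r \<noteq> (0 :: 'f)"
  proof (rule ccontr)
    assume "\<not> ?thesis"
    then have "Poly_Mapping.lookup (deriv_poly f) r = 0"
      unfolding lookup_deriv_poly by (intro sum.neutral) simp
    with assms show False by (simp add: in_keys_iff)
  qed
  then show ?thesis using that by (auto simp: in_keys_iff)
qed

abbreviation derivs :: "nat \<Rightarrow> ('x \<times> nat) list \<Rightarrow> ('x, 'f::field) diff_poly"
  where "derivs i u \<equiv> (deriv_poly ^^ i) (Poly_Mapping.single (Nc_Word u) 1)"

text \<open>Each derivation raises exactly one letter, by one.\<close>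

lemma keys_derivs:
  assumes "Nc_Word r \<in> Poly_Mapping.keys (derivs i u :: ('x, 'f::field) diff_poly)"
  shows "le_word u r \<and> total_order r = total_order u + i"
  using assms
proof (induction i arbitrary: r)
  case 0
  then show ?case by (simp add: le_word_refl)
next
  case (Suc i)
  then obtain w where w: "w \<in> Poly_Mapping.keys (derivs i u :: ('x, 'f) diff_poly)"
    "Nc_Word r \<in> Poly_Mapping.keys (deriv_word (letters w) :: ('x, 'f) diff_poly)"
    by (auto elim: keys_deriv_polyE)
  then obtain j where "j < length (letters w)" "r = raise_at j (letters w)"
    by (auto elim: keys_deriv_wordE)
  moreover have "le_word u (letters w) \<and> total_order (letters w) = total_order u + i"
    using Suc.IH w(1) by simp
  ultimately show ?case
    by (auto simp: total_order_raise_at intro: le_word_trans[OF _ le_word_raise_at])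
qed

lemma lookup_deriv_word_last:
  "Poly_Mapping.lookup (deriv_word (u @ [(y, e)])) (Nc_Word (u @ [(y, Suc e)])) = (1 :: 'f::field)"
proof -
  have "raise_at j (u @ [(y, e)]) \<noteq> u @ [(y, Suc e)]" if "j < length u" for j
    using that by (simp add: raise_at_def list_update_append)
  moreover have "raise_at (length u) (u @ [(y, e)]) = u @ [(y, Suc e)]"
    by (simp add: raise_at_def)
  ultimately show ?thesis
    by (simp add: deriv_word_def lookup_add lookup_sum lookup_single)
qed

text \<open>There is only one way to reach this word: every derivation must hit the last letter.
  Hence no multinomial coefficient occurs, whatever the characteristic.\<close>

lemma lookup_derivs_last:
  "Poly_Mapping.lookup (derivs i (u @ [(y, e)])) (Nc_Word (u @ [(y, e + i)])) = (1 :: 'f::field)"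
proof (induction i)
  case 0
  then show ?case by simp
next
  case (Suc i)
  let ?F = "derivs i (u @ [(y, e)]) :: ('a, 'f) diff_poly"
  let ?r = "u @ [(y, e + i)]" and ?t = "u @ [(y, Suc (e + i))]"
  \<comment> \<open>A predecessor of \<open>?t\<close> lies between \<open>u @ [(y, e)]\<close> and
    \<open>?t\<close>, so its prefix is \<open>u\<close>; its total order then determines the last
    letter.\<close>
  have only: "w = Nc_Word ?r"
    if w: "w \<in> Poly_Mapping.keys ?F"
      and t: "Nc_Word ?t \<in> Poly_Mapping.keys (deriv_word (letters w) :: ('a, 'f) diff_poly)" for w
  proof -
    obtain w' where w': "w = Nc_Word w'" by (cases w)
    from t obtain j where j: "j < length w'" "?t = raise_at j w'"
      unfolding w' by (auto elim: keys_deriv_wordE)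
    have le: "le_word (u @ [(y, e)]) w'" and ord: "total_order w' = total_order (u @ [(y, e)]) + i"
      using keys_derivs[where 'f = 'f, of w' i "u @ [(y, e)]"] w unfolding w' by simp_all
    have le': "le_word w' ?t"
      unfolding j(2) by (rule le_word_raise_at)
    obtain u1 l where w1: "w' = u1 @ [l]" "length u1 = length u"
      using le_word_length[OF le]
      by (metis Suc_inject length_append_singleton length_Suc_conv_rev)
    have "le_word u u1" "le_word u1 u" "fst l = y"
      using le le' by (simp_all add: w1 le_word_append) (simp add: le_word_def)
    then have "u1 = u"
      by (metis le_word_antisym le_word_total_order)
    moreover from this have "snd l = e + i"
      using ord w1 by (simp add: total_order_def)
    ultimately show "w = Nc_Word ?r"
      using w1 w' \<open>fst l = y\<close> by (simp add: prod_eq_iff)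
  qed
  have mem: "Nc_Word ?r \<in> Poly_Mapping.keys ?F"
    using Suc by (simp add: in_keys_iff)
  have "Poly_Mapping.lookup (deriv_poly ?F) (Nc_Word ?t)
      = (\<Sum>w\<in>{Nc_Word ?r}. Poly_Mapping.lookup ?F w
          * Poly_Mapping.lookup (deriv_word (letters w)) (Nc_Word ?t))"
    unfolding lookup_deriv_poly
    by (rule sum.mono_neutral_right) (use only mem in \<open>auto simp: in_keys_iff\<close>)
  also have "\<dots> = 1"
    using Suc by (simp add: lookup_deriv_word_last)
  finally show ?case by simp
qed

section \<open>Evaluation of differential polynomials\<close>

context unital_algebra
begin

definition diff_eval :: "'a \<Rightarrow> ('x \<Rightarrow> 'a) \<Rightarrow> ('x, 'f) diff_poly \<Rightarrow> 'a"
  where "diff_eval x a = poly_eval scale (\<lambda>(v, e). (commutator x ^^ e) (a v))"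

abbreviation diff_eval_word :: "'a \<Rightarrow> ('x \<Rightarrow> 'a) \<Rightarrow> ('x \<times> nat) list \<Rightarrow> 'a"
  where "diff_eval_word x a u \<equiv> prod_list (map (\<lambda>(v, e). (commutator x ^^ e) (a v)) u)"

lemma commutator_diff_eval_word:
  "commutator x (diff_eval_word x a u) = (\<Sum>j<length u. diff_eval_word x a (raise_at j u))"
proof (induction u)
  case Nil
  then show ?case by (simp add: commutator_one_right)
next
  case (Cons l u)
  have "raise_at (Suc j) (l # u) = l # raise_at j u" for j
    by (simp add: raise_at_def)
  moreover have "raise_at 0 (l # u) = (fst l, Suc (snd l)) # u"
    by (simp add: raise_at_def)
  ultimately show ?case
    using Cons
    by (simp add: sum.lessThan_Suc_shift commutator_mult_right sum_distrib_left case_prod_beta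
        del: sum.lessThan_Suc)
qed

text \<open>Evaluation intertwines the formal derivation with \<open>commutator x\<close>, because
  the latter satisfies the Leibniz rule too.\<close>

lemma diff_eval_deriv_poly: "diff_eval x a (deriv_poly f) = commutator x (diff_eval x a f)"
proof -
  have word: "poly_eval scale (\<lambda>(v, e). (commutator x ^^ e) (a v)) (deriv_word u)
      = commutator x (diff_eval_word x a u)" for u
    by (simp add: commutator_diff_eval_word deriv_word_def poly_eval_sum poly_eval_single)
  show ?thesis
    unfolding diff_eval_def deriv_poly_def poly_eval_sum poly_eval_fscale word
    by (simp only: poly_eval_def commutator_sum_right commutator_scale_right)
qed

lemma diff_eval_derivs:
  "diff_eval x a (derivs i u) = (commutator x ^^ i) (diff_eval_word x a u)"
proof (induction i)
  case 0
  show ?case by (simp add: diff_eval_def poly_eval_single)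
next
  case (Suc i)
  then show ?case by (simp add: diff_eval_deriv_poly)
qed

end

section \<open>Splitting words at a letter and eliminating a variable\<close>

definition before :: "'x \<Rightarrow> ('x \<times> nat) list \<Rightarrow> ('x \<times> nat) list"
  where "before v u = takeWhile (\<lambda>l. fst l \<noteq> v) u"

definition after :: "'x \<Rightarrow> ('x \<times> nat) list \<Rightarrow> ('x \<times> nat) list"
  where "after v u = tl (dropWhile (\<lambda>l. fst l \<noteq> v) u)"

lemma split_at_letter:
  assumes "distinct (map fst u)" "(v, e) \<in> set u"
  shows "u = before v u @ (v, e) # after v u"
    and "v \<notin> fst ` set (before v u)" "v \<notin> fst ` set (after v u)"
proof -
  obtain u1 u2 where u: "u = u1 @ (v, e) # u2"
    using assms(2) by (auto dest: split_list)
  have notin: "v \<notin> fst ` set u1" "v \<notin> fst ` set u2"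
    using assms(1) by (auto simp: u)
  then have "\<forall>l\<in>set u1. fst l \<noteq> v" by force
  then have "before v u = u1" "after v u = u2"
    by (simp_all add: before_def after_def u takeWhile_append2 dropWhile_append2)
  with u notin show "u = before v u @ (v, e) # after v u"
    "v \<notin> fst ` set (before v u)" "v \<notin> fst ` set (after v u)" by simp_all
qed

text \<open>The zero polynomial qualifies for every \<open>V\<close> and \<open>k\<close>, so
  nonvanishing has to be tracked separately.\<close>

definition multihomogeneous :: "'x set \<Rightarrow> nat \<Rightarrow> ('x, 'f::field) diff_poly \<Rightarrow> bool"
  where "multihomogeneous V k f \<longleftrightarrow> (\<forall>w\<in>Poly_Mapping.keys f. distinct (map fst (letters w))
    \<and> fst ` set (letters w) = V \<and> total_order (letters w) = k)"

text \<open>Up to sign, this is what the substitution of \<open>x\<^sup>i\<close> for the letter \<open>(v, e)\<close> leaves of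
  \<open>f\<close>, provided that the same expression vanishes for all smaller \<open>i\<close>.\<close>

definition contract :: "'x \<Rightarrow> nat \<Rightarrow> nat \<Rightarrow> ('x, 'f::field) diff_poly \<Rightarrow> ('x, 'f) diff_poly"
  where "contract v e i f = (\<Sum>w | w \<in> Poly_Mapping.keys f \<and> (v, e) \<in> set (letters w).
    fscale (Poly_Mapping.lookup f w)
      (derivs i (before v (letters w)) * Poly_Mapping.single (Nc_Word (after v (letters w))) 1))"

text \<open>Removing \<open>(v, e)\<close> lowers the total order by \<open>e\<close>, and the
  derivations of the prefix add \<open>i\<close>. The subtraction never truncates where it matters:
  a word containing \<open>(v, e)\<close> has total order at least \<open>e\<close>.\<close>

lemma multihomogeneous_contract:
  fixes f :: "('x, 'f::field) diff_poly"
  assumes f: "multihomogeneous V k f"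
  shows "multihomogeneous (V - {v}) (k - e + i) (contract v e i f)"
  unfolding multihomogeneous_def
proof
  fix w' assume "w' \<in> Poly_Mapping.keys (contract v e i f)"
  then obtain w where w: "w \<in> Poly_Mapping.keys f" "(v, e) \<in> set (letters w)"
    and "w' \<in> Poly_Mapping.keys (fscale (Poly_Mapping.lookup f w)
      (derivs i (before v (letters w)) * Poly_Mapping.single (Nc_Word (after v (letters w))) 1))"
    using keys_sum[of _ "{w. w \<in> Poly_Mapping.keys f \<and> (v, e) \<in> set (letters w)}"]
    unfolding contract_def by fast
  then have "w' \<in> Poly_Mapping.keys ((derivs i (before v (letters w)) :: ('x, 'f) diff_poly)
      * Poly_Mapping.single (Nc_Word (after v (letters w))) 1)"
    using keys_fscale by fast
  then obtain r where r: "Nc_Word r \<in> Poly_Mapping.keys (derivs i (before v (letters w)) :: ('x, 'f) diff_poly)"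
    and w': "w' = Nc_Word (r @ after v (letters w))"
    by (rule keys_times_singleE)
  have le: "le_word (before v (letters w)) r"
    and ord: "total_order r = total_order (before v (letters w)) + i"
    using keys_derivs[OF r] by simp_all
  have fst: "map fst r = map fst (before v (letters w))"
    using le_word_map_fst[OF le] by simp
  then have fst': "fst ` set r = fst ` set (before v (letters w))"
    by (metis set_map)
  have hom: "distinct (map fst (letters w))" "fst ` set (letters w) = V" "total_order (letters w) = k"
    using f w by (simp_all add: multihomogeneous_def)
  note split = split_at_letter[OF hom(1) w(2)]
  have "distinct (map fst (before v (letters w) @ (v, e) # after v (letters w)))"
    "fst ` set (before v (letters w) @ (v, e) # after v (letters w)) = V"
    "total_order (before v (letters w) @ (v, e) # after v (letters w)) = k"
    using hom split(1) by simp_all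
  then show "distinct (map fst (letters w')) \<and> fst ` set (letters w') = V - {v}
      \<and> total_order (letters w') = k - e + i"
    using split(2,3) ord unfolding w' by (auto simp: fst fst' image_Un total_order_def)
qed

text \<open>A word \<open>t\<close> produced by only one summand cannot cancel: its coefficient is
  that of \<open>w0\<close> in \<open>f\<close>.\<close>

lemma contract_nonzeroI:
  fixes f :: "('x, 'f::field) diff_poly"
  assumes "w0 \<in> Poly_Mapping.keys f" "(v, e) \<in> set (letters w0)"
    and one: "Poly_Mapping.lookup ((derivs i (before v (letters w0)) :: ('x, 'f) diff_poly)
      * Poly_Mapping.single (Nc_Word (after v (letters w0))) 1) t = 1"
    and unique: "\<And>w. w \<in> Poly_Mapping.keys f \<Longrightarrow> (v, e) \<in> set (letters w) \<Longrightarrow>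
      t \<in> Poly_Mapping.keys ((derivs i (before v (letters w)) :: ('x, 'f) diff_poly)
      * Poly_Mapping.single (Nc_Word (after v (letters w))) 1) \<Longrightarrow> w = w0"
  shows "contract v e i f \<noteq> 0"
proof -
  let ?g = "\<lambda>w. Poly_Mapping.lookup f w * Poly_Mapping.lookup
    ((derivs i (before v (letters w)) :: ('x, 'f) diff_poly)
      * Poly_Mapping.single (Nc_Word (after v (letters w))) 1) t"
  have "Poly_Mapping.lookup (contract v e i f) t
      = sum ?g {w. w \<in> Poly_Mapping.keys f \<and> (v, e) \<in> set (letters w)}"
    by (simp add: contract_def lookup_sum lookup_fscale)
  also have "\<dots> = sum ?g {w0}"
  proof (rule sum.mono_neutral_right)
    show "\<forall>w\<in>{w. w \<in> Poly_Mapping.keys f \<and> (v, e) \<in> set (letters w)} - {w0}. ?g w = 0"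
    proof
      fix w assume "w \<in> {w. w \<in> Poly_Mapping.keys f \<and> (v, e) \<in> set (letters w)} - {w0}"
      then have w: "w \<in> Poly_Mapping.keys f" "(v, e) \<in> set (letters w)" "w \<noteq> w0"
        by simp_all
      show "?g w = 0"
      proof (rule ccontr)
        assume "?g w \<noteq> 0"
        then have "t \<in> Poly_Mapping.keys ((derivs i (before v (letters w)) :: ('x, 'f) diff_poly)
            * Poly_Mapping.single (Nc_Word (after v (letters w))) 1)"
          by (simp add: in_keys_iff)
        then show False using unique w by blast
      qed
    qed
  qed (use assms(1,2) in auto)
  also have "\<dots> \<noteq> 0"
    using assms(1) by (simp add: one in_keys_iff)
  finally show ?thesis by auto
qed

text \<open>Among the words with the longest prefix before the letter \<open>(v, e)\<close> choose one whose prefix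
  ends in a letter of maximal order. Differentiating only this last letter, more often than the
  total order, gives a word that cannot arise from any other word.\<close>

lemma ex_contract_nonzero:
  fixes f :: "('x, 'f::field) diff_poly"
  assumes f: "multihomogeneous V k f"
    and w: "w \<in> Poly_Mapping.keys f" "(v, e) \<in> set (letters w)"
  shows "\<exists>i. contract v e i f \<noteq> 0"
proof -
  define S where "S = {w. w \<in> Poly_Mapping.keys f \<and> (v, e) \<in> set (letters w)}"
  have fin: "finite S" and ne: "S \<noteq> {}" using w by (auto simp: S_def)
  have S: "letters w = before v (letters w) @ (v, e) # after v (letters w)"
    "total_order (letters w) = k" if "w \<in> S" for w
  proof -
    have "w \<in> Poly_Mapping.keys f" "(v, e) \<in> set (letters w)"
      using that by (simp_all add: S_def)
    with f show "letters w = before v (letters w) @ (v, e) # after v (letters w)"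
      "total_order (letters w) = k"
      by (auto simp: multihomogeneous_def intro: split_at_letter(1))
  qed
  \<comment> \<open>The letter between prefix and suffix is always \<open>(v, e)\<close>.\<close>
  have eqI: "w = w'" if "w \<in> S" "w' \<in> S" "before v (letters w) = before v (letters w')"
    "after v (letters w) = after v (letters w')" for w w'
    using that S(1)[of w] S(1)[of w'] by (metis nc_word.expand)
  define n where "n = Max ((\<lambda>w. length (before v (letters w))) ` S)"
  have n_ge: "length (before v (letters w)) \<le> n" if "w \<in> S" for w
    using fin that by (simp add: n_def)
  have "n \<in> (\<lambda>w. length (before v (letters w))) ` S"
    unfolding n_def using fin ne by (intro Max_in) auto
  then obtain w1 where w1: "w1 \<in> S" "length (before v (letters w1)) = n" by auto
  show ?thesis
  proof (cases n)
    case 0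
    then have nil: "before v (letters w) = []" if "w \<in> S" for w
      using n_ge[OF that] by simp
    have "contract v e 0 f \<noteq> 0"
    proof (rule contract_nonzeroI[where t = "Nc_Word (after v (letters w1))"])
      show "w1 \<in> Poly_Mapping.keys f" "(v, e) \<in> set (letters w1)"
        using w1 by (auto simp: S_def)
    qed (use nil w1 eqI in \<open>auto simp: S_def mult_single plus_nc_word_def\<close>)
    then show ?thesis ..
  next
    case (Suc n')
    define T where "T = {w \<in> S. length (before v (letters w)) = n}"
    define m where "m = Max ((\<lambda>w. snd (last (before v (letters w)))) ` T)"
    have fin': "finite T" and ne': "T \<noteq> {}"
      using fin w1 by (auto simp: T_def)
    have m_ge: "snd (last (before v (letters w))) \<le> m" if "w \<in> T" for w
      using fin' that by (simp add: m_def)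
    have "m \<in> (\<lambda>w. snd (last (before v (letters w)))) ` T"
      unfolding m_def using fin' ne' by (intro Max_in) auto
    then obtain w0 where w0: "w0 \<in> T" "snd (last (before v (letters w0))) = m" by auto
    have w0S: "w0 \<in> S" using w0 by (simp add: T_def)
    have len0: "length (before v (letters w0)) = Suc n'"
      using w0 Suc by (simp add: T_def)
    then obtain u y where u: "before v (letters w0) = u @ [(y, m)]"
      using w0(2) by (metis append_butlast_last_id length_greater_0_conv prod.collapse zero_less_Suc)
    have len_u: "length u = n'" using len0 u by simp
    have "contract v e (Suc k) f \<noteq> 0"
    \<comment> \<open>All \<open>Suc k\<close> derivations are spent on the last letter of the
      prefix of \<open>w0\<close>, pushing its order above the total order \<open>k\<close> of any
      word of \<open>f\<close>.\<close>
    proof (rule contract_nonzeroI[where t = "Nc_Word ((u @ [(y, m + Suc k)]) @ after v (letters w0))"])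
      show "w0 \<in> Poly_Mapping.keys f" "(v, e) \<in> set (letters w0)"
        using w0S by (auto simp: S_def)
      show "Poly_Mapping.lookup ((derivs (Suc k) (before v (letters w0)) :: ('x, 'f) diff_poly)
          * Poly_Mapping.single (Nc_Word (after v (letters w0))) 1)
          (Nc_Word ((u @ [(y, m + Suc k)]) @ after v (letters w0))) = 1"
        unfolding lookup_times_single_append u by (rule lookup_derivs_last)
    next
      fix w assume "w \<in> Poly_Mapping.keys f" "(v, e) \<in> set (letters w)"
      then have wS: "w \<in> S" by (simp add: S_def)
      assume "Nc_Word ((u @ [(y, m + Suc k)]) @ after v (letters w0))
        \<in> Poly_Mapping.keys ((derivs (Suc k) (before v (letters w)) :: ('x, 'f) diff_poly)
          * Poly_Mapping.single (Nc_Word (after v (letters w))) 1)"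
      then obtain r where r: "Nc_Word r \<in> Poly_Mapping.keys
          (derivs (Suc k) (before v (letters w)) :: ('x, 'f) diff_poly)"
        and eq: "(u @ [(y, m + Suc k)]) @ after v (letters w0) = r @ after v (letters w)"
        by (rule keys_times_singleE) auto
      have le: "le_word (before v (letters w)) r"
        and ord: "total_order r = total_order (before v (letters w)) + Suc k"
        using keys_derivs[OF r] by simp_all
      have len_r: "length r = length (before v (letters w))"
        using le_word_length[OF le] by simp
      \<comment> \<open>A shorter \<open>r\<close> would leave the letter of order
        \<open>m + Suc k\<close> in the undifferentiated suffix of \<open>w\<close>, whose orders
        sum to at most \<open>k\<close>.\<close>
      have r_eq: "r = u @ [(y, m + Suc k)]"
      proof (cases "length r = n")
        case True
        then show ?thesis
          using eq len_u Suc by (simp add: append_eq_append_conv del: append_assoc)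
      next
        case False
        then have "length r \<le> length u"
          using n_ge[OF wS] len_r len_u Suc by simp
        then have "after v (letters w) = drop (length r) u @ (y, m + Suc k) # after v (letters w0)"
          using arg_cong[OF eq, of "drop (length r)"] by simp
        then have "(y, m + Suc k) \<in> set (after v (letters w))"
          by simp
        then have "(y, m + Suc k) \<in> set (letters w)"
          using S(1)[OF wS] by (metis in_set_conv_decomp append_Cons append_assoc)
        then have "m + Suc k \<le> total_order (letters w)"
          unfolding total_order_def by (intro member_le_sum_list) (force, simp)
        then show ?thesis using S(2)[OF wS] by simp
      qed
      then have after: "after v (letters w) = after v (letters w0)"
        using eq by simp
      have "w \<in> T" using wS len_r r_eq len_u Suc by (simp add: T_def)
      obtain u' l where u': "before v (letters w) = u' @ [l]" "length u' = length u"
        using len_r r_eq by (metis length_append_singleton length_Suc_conv_rev)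
      \<comment> \<open>Maximality of \<open>m\<close> enters here: it puts the prefix of
        \<open>w\<close> below that of \<open>w0\<close>, and their total orders agree since both
        were differentiated \<open>Suc k\<close> times.\<close>
      have "snd l \<le> m" using m_ge[OF \<open>w \<in> T\<close>] u' by simp
      then have "le_word (before v (letters w)) (u @ [(y, m)])"
        using le u'(2) unfolding r_eq u'(1) le_word_append[OF u'(2)] by (simp add: le_word_def)
      then have "before v (letters w) = u @ [(y, m)]"
        by (rule le_word_antisym) (use ord r_eq in \<open>simp add: total_order_def\<close>)
      then show "w = w0" using eqI[OF wS w0S] u after by simp
    qed
    then show ?thesis ..
  qed
qed

section \<open>Substituting a power of \<open>x\<close> for a letter\<close>

lemma alternating_recurrence:
  fixes E :: "nat \<Rightarrow> nat \<Rightarrow> 'a::ring_1"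
  assumes rec: "\<And>i j. E j (Suc i) = x * E j i - E (Suc j) i"
    and zero: "\<And>j. j < s \<Longrightarrow> E j 0 = 0"
  shows "i + j < s \<Longrightarrow> E j i = 0" and "i + j = s \<Longrightarrow> E j i = (- 1) ^ i * E s 0"
proof -
  show less: "E j i = 0" if "i + j < s" for i j
    using that by (induction i arbitrary: j) (simp_all add: rec zero)
  \<comment> \<open>In the recurrence for a point of the antidiagonal \<open>i + j = s\<close>, the
    term with factor \<open>x\<close> lies below the antidiagonal and vanishes; the other term stays
    on it and contributes a sign.\<close>
  show "E j i = (- 1) ^ i * E s 0" if "i + j = s"
    using that by (induction i arbitrary: j) (simp_all add: rec less)
qed

context unital_algebra
begin

lemma diff_eval_contract:
  "diff_eval x a (contract v e i f) = (\<Sum>w | w \<in> Poly_Mapping.keys f \<and> (v, e) \<in> set (letters w).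
    scale (Poly_Mapping.lookup f w) ((commutator x ^^ i) (diff_eval_word x a (before v (letters w)))
      * diff_eval_word x a (after v (letters w))))"
proof -
  have "diff_eval x a (derivs i u * Poly_Mapping.single (Nc_Word u') 1)
      = (commutator x ^^ i) (diff_eval_word x a u) * diff_eval_word x a u'" for u u'
    using diff_eval_derivs[of x a i u] by (simp add: diff_eval_def poly_eval_times poly_eval_single)
  then show ?thesis
    by (simp add: contract_def diff_eval_def poly_eval_sum poly_eval_fscale)
qed

text \<open>Pulling the factors \<open>x\<close> out to the left, one by one, replaces each of them by a commutator
  with the product of the letters to its left.\<close>

lemma sum_insert_power:
  fixes U U' :: "'w \<Rightarrow> 'a"
  assumes zero: "\<And>i. i < s \<Longrightarrow> (\<Sum>w\<in>S. scale (c w) ((commutator x ^^ i) (U w) * U' w)) = 0"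
  shows "(\<Sum>w\<in>S. scale (c w) (U w * x ^ s * U' w))
    = (- 1) ^ s * (\<Sum>w\<in>S. scale (c w) ((commutator x ^^ s) (U w) * U' w))"
proof -
  define E where "E = (\<lambda>j i. \<Sum>w\<in>S. scale (c w) ((commutator x ^^ j) (U w) * x ^ i * U' w))"
  \<comment> \<open>This is \<open>y * x = x * y - commutator x y\<close> for
    \<open>y = (commutator x ^^ j) (U w)\<close>.\<close>
  have "E j (Suc i) = x * E j i - E (Suc j) i" for i j
    unfolding E_def sum_distrib_left sum_subtractf[symmetric]
    by (intro sum.cong refl)
      (simp add: commutator_def scale_mult_right flip: scale_right_diff_distrib,
       simp add: algebra_simps power_commutes flip: mult.assoc)
  moreover have "E j 0 = 0" if "j < s" for j
    using zero[OF that] by (simp add: E_def)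
  ultimately have "E 0 s = (- 1) ^ s * E s 0"
    by (rule alternating_recurrence) simp_all
  then show ?thesis by (simp add: E_def)
qed

end

section \<open>Algebras with a surjective inner derivation\<close>

lemma prod_list_zero: "0 \<in> set xs \<Longrightarrow> prod_list xs = (0 :: 'a::semiring_1)"
  by (induction xs) auto

lemma funpow_commutator_power: "n > 0 \<Longrightarrow> (commutator x ^^ n) (x ^ s) = 0"
  by (cases n) (simp_all add: funpow_Suc_right commutator_def power_commutes funpow_commutator_zero
      del: funpow.simps)

lemma ex_least_order:
  assumes "multihomogeneous V k f" "f \<noteq> 0" "v \<in> V"
  obtains w e where "w \<in> Poly_Mapping.keys f" "(v, e) \<in> set (letters w)"
    "\<And>w' e'. w' \<in> Poly_Mapping.keys f \<Longrightarrow> (v, e') \<in> set (letters w') \<Longrightarrow> e \<le> e'"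
proof -
  let ?P = "\<lambda>e. \<exists>w\<in>Poly_Mapping.keys f. (v, e) \<in> set (letters w)"
  obtain w where "w \<in> Poly_Mapping.keys f" using assms(2) by fastforce
  moreover from this have "v \<in> fst ` set (letters w)"
    using assms(1,3) by (simp add: multihomogeneous_def)
  ultimately have "\<exists>e. ?P e" by force
  then have "?P (LEAST e. ?P e)" by (rule LeastI_ex)
  then obtain w' where "w' \<in> Poly_Mapping.keys f" "(v, LEAST e. ?P e) \<in> set (letters w')"
    by blast
  then show ?thesis
  proof (rule that)
    fix w' e' assume "w' \<in> Poly_Mapping.keys f" "(v, e') \<in> set (letters w')"
    then show "(LEAST e. ?P e) \<le> e'" by (intro Least_le) blast
  qed
qed

text \<open>Distinctness leaves room for a single letter, and the total order fixes its
  order.\<close>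

lemma multihomogeneous_singleton:
  assumes "multihomogeneous {v} k f" "w \<in> Poly_Mapping.keys f"
  shows "w = Nc_Word [(v, k)]"
proof -
  have w: "distinct (map fst (letters w))" "fst ` set (letters w) = {v}" "total_order (letters w) = k"
    using assms by (simp_all add: multihomogeneous_def)
  have "length (letters w) = card (fst ` set (letters w))"
    using distinct_card[OF w(1)] by simp
  then obtain l where "letters w = [l]"
    using w(2) by (auto simp: length_Suc_conv)
  then show ?thesis
    using w(2,3) by (cases w) (auto simp: total_order_def)
qed

context unital_algebra
begin

theorem diff_poly_surjective:
  fixes x :: 'a and f :: "('x, 'f) diff_poly"
  assumes surj: "surj (commutator x)"
    and "finite V" "V \<noteq> {}" "multihomogeneous V k f" "f \<noteq> 0"
  shows "\<exists>a. diff_eval x a f = b"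
  using assms(2-)
proof (induction V arbitrary: k f b rule: finite_ne_induct)
  case (singleton v)
  let ?c = "Poly_Mapping.lookup f (Nc_Word [(v, k)])"
  have "Poly_Mapping.keys f \<noteq> {}"
    using singleton.prems(2) by simp
  then have keys: "Poly_Mapping.keys f = {Nc_Word [(v, k)]}"
    using multihomogeneous_singleton[OF singleton.prems(1)] by blast
  then have c: "?c \<noteq> 0" by (simp flip: in_keys_iff)
  \<comment> \<open>Here \<open>f\<close> is the single term \<open>?c\<close> times the letter
    \<open>(v, k)\<close>, and \<open>?c\<close> can be inverted.\<close>
  obtain z where z: "(commutator x ^^ k) z = scale (inverse ?c) b"
    using surj_funpow[OF surj] by (metis surjD)
  have "diff_eval x (\<lambda>_. z) f = b"
    using c z by (simp add: diff_eval_def poly_eval_def keys)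
  then show ?case by (rule exI[of _ "\<lambda>_. z"])
next
  case (insert v V)
  obtain w0 e where w0: "w0 \<in> Poly_Mapping.keys f" "(v, e) \<in> set (letters w0)"
    and e_le: "\<And>w' e'. w' \<in> Poly_Mapping.keys f \<Longrightarrow> (v, e') \<in> set (letters w') \<Longrightarrow> e \<le> e'"
    using ex_least_order[OF insert.prems insertI1] by blast
  define s where "s = (LEAST i. contract v e i f \<noteq> 0)"
  have s: "contract v e s f \<noteq> 0"
    unfolding s_def by (rule LeastI_ex) (rule ex_contract_nonzero[OF insert.prems(1) w0])
  have less_s: "contract v e i f = 0" if "i < s" for i
    using not_less_Least[OF that[unfolded s_def]] by simp
  have "multihomogeneous V (k - e + s) (contract v e s f)"
    using multihomogeneous_contract[OF insert.prems(1), of v e s] insert.hyps by simp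
  \<comment> \<open>The sign anticipates the one produced by \<open>sum_insert_power\<close>; the
    two cancel at the end.\<close>
  then obtain a where a: "diff_eval x a (contract v e s f) = (- 1) ^ s * b"
    using insert.IH s by blast
  obtain z where z: "(commutator x ^^ e) z = x ^ s"
    using surj_funpow[OF surj] by (metis surjD)
  let ?a = "a(v := z)"
  let ?S = "{w. w \<in> Poly_Mapping.keys f \<and> (v, e) \<in> set (letters w)}"
  have hom: "distinct (map fst (letters w))" "fst ` set (letters w) = insert v V"
    if "w \<in> Poly_Mapping.keys f" for w
    using insert.prems(1) that by (simp_all add: multihomogeneous_def)
  \<comment> \<open>Prefixes and suffixes do not contain \<open>v\<close>, so the value chosen for
    \<open>v\<close> does not disturb the induction hypothesis.\<close>
  have indep: "diff_eval_word x ?a u = diff_eval_word x a u" if "v \<notin> fst ` set u" for u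
    by (rule arg_cong[where f = prod_list], rule map_cong) (use that in force)+
  \<comment> \<open>By minimality of \<open>e\<close>, such a word contains \<open>v\<close> with a
    higher order, hence a proper derivative of \<open>x ^ s\<close>, and \<open>x\<close> commutes
    with its powers.\<close>
  have vanish: "diff_eval_word x ?a (letters w) = 0"
    if w: "w \<in> Poly_Mapping.keys f" and ve: "(v, e) \<notin> set (letters w)" for w
  proof -
    have "v \<in> fst ` set (letters w)" using hom(2)[OF w] by simp
    then obtain e' where e': "(v, e') \<in> set (letters w)" by force
    then have "e < e'" using e_le[OF w e'] ve by (cases "e = e'") auto
    then obtain n where n: "e' = n + e" "n > 0"
      by (metis add.commute less_imp_add_positive)
    have "(commutator x ^^ e') (?a v) = 0"
      using n by (simp add: funpow_add z funpow_commutator_power)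
    with e' have "0 \<in> set (map (\<lambda>(v, e). (commutator x ^^ e) (?a v)) (letters w))"
      by force
    then show ?thesis by (rule prod_list_zero)
  qed
  have split: "diff_eval_word x ?a (letters w)
      = diff_eval_word x a (before v (letters w)) * x ^ s * diff_eval_word x a (after v (letters w))"
    if w: "w \<in> ?S" for w
  proof -
    have w': "w \<in> Poly_Mapping.keys f" "(v, e) \<in> set (letters w)" using w by simp_all
    note split = split_at_letter[OF hom(1)[OF w'(1)] w'(2)]
    show ?thesis
      by (subst split(1)) (simp add: indep split(2,3) z mult.assoc del: fun_upd_apply, simp add: z)
  qed
  have "diff_eval x ?a f = (\<Sum>w\<in>?S. scale (Poly_Mapping.lookup f w)
      (diff_eval_word x a (before v (letters w)) * x ^ s * diff_eval_word x a (after v (letters w))))"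
    unfolding diff_eval_def poly_eval_def
    by (rule sum.mono_neutral_cong_right) (use vanish split in auto)
  also have "\<dots> = (- 1) ^ s * diff_eval x a (contract v e s f)"
    unfolding diff_eval_contract
  proof (rule sum_insert_power)
    fix i assume "i < s"
    then show "(\<Sum>w\<in>?S. scale (Poly_Mapping.lookup f w)
        ((commutator x ^^ i) (diff_eval_word x a (before v (letters w)))
          * diff_eval_word x a (after v (letters w)))) = 0"
      using less_s diff_eval_contract[of x a v e i f] by (simp add: diff_eval_def poly_eval_zero)
  qed
  also have "\<dots> = b" unfolding a by (cases "even s") simp_all
  finally show ?case by (rule exI[of _ ?a])
qed

end

section \<open>Multilinear polynomials as differential polynomials of order zero\<close>

lemma prod_list_fvar: "prod_list (map fvar u) = Poly_Mapping.single (Nc_Word u) 1"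
  by (induction u) (simp_all add: fvar_def mult_single plus_nc_word_def flip: zero_nc_word_def)

lemma multilinear_keysD:
  assumes "multilinear m f" "w \<in> Poly_Mapping.keys f"
  shows "distinct (letters w)" "set (letters w) = {1..m}"
proof -
  obtain c where f: "f = (\<Sum>s | s permutes {1..m}.
      fscale (c s) (prod_list (map (\<lambda>i. fvar (s i)) [1..<Suc m])))"
    using assms(1) by (auto simp: multilinear_def)
  have "prod_list (map (\<lambda>i. fvar (s i)) [1..<Suc m])
      = Poly_Mapping.single (Nc_Word (map s [1..<Suc m])) (1 :: 'a)" for s :: "nat \<Rightarrow> nat"
    unfolding prod_list_fvar[symmetric] by (simp only: map_map o_def)
  then have f': "f = (\<Sum>s | s permutes {1..m}. Poly_Mapping.single (Nc_Word (map s [1..<Suc m])) (c s))"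
    unfolding f by (simp only: fscale_def mult_single add_0 mult_1_right)
  have "w \<in> (\<Union>s\<in>{s. s permutes {1..m}}.
      Poly_Mapping.keys (Poly_Mapping.single (Nc_Word (map s [1..<Suc m])) (c s)))"
    using assms(2) unfolding f' by (rule keys_sum[THEN subsetD])
  then obtain s where s: "s permutes {1..m}" and w: "letters w = map s [1..<Suc m]"
    by (auto split: if_splits simp del: upt_Suc)
  have set: "set [1..<Suc m] = {1..m}" by auto
  show "distinct (letters w)"
    unfolding w distinct_map set using permutes_inj_on[OF s] by (simp del: upt_Suc)
  show "set (letters w) = {1..m}"
    unfolding w set_map set by (rule permutes_image[OF s])
qed

definition order_zero :: "'x nc_word \<Rightarrow> ('x \<times> nat) nc_word"
  where "order_zero w = Nc_Word (map (\<lambda>v. (v, 0)) (letters w))"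

lemma inj_order_zero: "inj order_zero"
  by (rule injI, rule nc_word.expand) (simp add: order_zero_def map_injective inj_on_def)

context unital_algebra
begin

theorem multilinear_surjective:
  fixes x :: 'a and f :: "(nat, 'f) free_algebra"
  assumes surj: "surj (commutator x)"
    and m: "m \<ge> 1" and f: "multilinear m f" "f \<noteq> 0"
  shows "poly_image scale f = UNIV"
proof -
  \<comment> \<open>Each indeterminate is read as its own derivative of order zero, so the total
    order is 0.\<close>
  define g where "g = (\<Sum>w\<in>Poly_Mapping.keys f.
    Poly_Mapping.single (order_zero w) (Poly_Mapping.lookup f w))"
  have eval: "diff_eval x a g = poly_eval scale a f" for a
    by (simp add: g_def diff_eval_def poly_eval_sum poly_eval_single)
      (simp add: poly_eval_def order_zero_def o_def)
  have "multihomogeneous {1..m} 0 g"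
    unfolding multihomogeneous_def
  proof
    fix w' assume "w' \<in> Poly_Mapping.keys g"
    then have "w' \<in> (\<Union>w\<in>Poly_Mapping.keys f.
        Poly_Mapping.keys (Poly_Mapping.single (order_zero w) (Poly_Mapping.lookup f w)))"
      unfolding g_def by (rule keys_sum[THEN subsetD])
    then obtain w where w: "w \<in> Poly_Mapping.keys f" "w' = order_zero w"
      by (auto split: if_splits)
    then show "distinct (map fst (letters w')) \<and> fst ` set (letters w') = {1..m}
        \<and> total_order (letters w') = 0"
      using multilinear_keysD[OF f(1) w(1)]
      by (simp add: order_zero_def o_def image_image total_order_def)
  qed
  moreover have "g \<noteq> 0"
  proof -
    obtain w where w: "w \<in> Poly_Mapping.keys f" using f(2) by fastforce
    \<comment> \<open>Relabelling is injective on words, so no coefficients merge.\<close>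
    have "Poly_Mapping.lookup g (order_zero w)
        = (\<Sum>w'\<in>Poly_Mapping.keys f. if w' = w then Poly_Mapping.lookup f w' else 0)"
      by (simp add: g_def lookup_sum lookup_single when_def inj_eq[OF inj_order_zero])
    also have "\<dots> = Poly_Mapping.lookup f w"
      using w by simp
    finally show ?thesis using w by (auto simp: in_keys_iff)
  qed
  ultimately have "\<exists>a. diff_eval x a g = b" for b
    using m by (intro diff_poly_surjective[OF surj, of "{1..m}" 0]) auto
  then have "b \<in> poly_image scale f" for b
    unfolding poly_image_def eval by (metis (mono_tags, lifting) mem_Collect_eq)
  then show ?thesis by blast
qed

end

section \<open>The Weyl algebra\<close>

text \<open>The classes of words span the algebra, and a word is built from 1 by left multiplication
  with generators.\<close>

lemma weyl_induct [case_names zero add scale one p q]: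
  fixes z :: "('n, 'f::field) weyl"
  assumes zero: "P 0" and add: "\<And>y z. P y \<Longrightarrow> P z \<Longrightarrow> P (y + z)"
    and scale: "\<And>c z. P z \<Longrightarrow> P (weyl_scale c z)" and one: "P 1"
    and p: "\<And>i z. P z \<Longrightarrow> P (weyl_p i * z)" and q: "\<And>i z. P z \<Longrightarrow> P (weyl_q i * z)"
  shows "P z"
proof -
  have single: "P (abs_weyl (Poly_Mapping.single (Nc_Word u) 1))" for u :: "'n weyl_gen list"
  proof (induction u)
    case Nil
    then show ?case using one by (simp add: one_weyl.abs_eq flip: zero_nc_word_def)
  next
    case (Cons l u)
    have eq: "abs_weyl (Poly_Mapping.single (Nc_Word (l # u)) (1 :: 'f))
        = abs_weyl (fvar l) * abs_weyl (Poly_Mapping.single (Nc_Word u) 1)"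
      by (simp add: times_weyl.abs_eq fvar_def mult_single plus_nc_word_def)
    show ?case
      using p[OF Cons] q[OF Cons] unfolding eq
      by (cases l) (simp_all add: weyl_p.abs_eq weyl_q.abs_eq)
  qed
  have "P (abs_weyl f)" for f :: "('n weyl_gen, 'f) free_algebra"
  proof (induction f rule: free_algebra_induct)
    case zero
    then show ?case using assms(1) by (simp add: zero_weyl.abs_eq)
  next
    case (single_plus w c f)
    have "abs_weyl (Poly_Mapping.single w c + f)
        = weyl_scale c (abs_weyl (Poly_Mapping.single (Nc_Word (letters w)) 1)) + abs_weyl f"
      by (simp add: plus_weyl.abs_eq weyl_scale.abs_eq fscale_def mult_single)
    then show ?case
      using add[OF scale[OF single[of "letters w"]] single_plus] by simp
  qed
  then show ?thesis by (induct z rule: weyl.abs_induct)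
qed

text \<open>Polynomials in \<open>y\<close> with right coefficients in the centralizer of
  \<open>x\<close>. Adding one monomial at a time yields an induction rule that reduces closure
  properties to a single \<open>y ^ k * c\<close>.\<close>

inductive_set commuting_span :: "'a::ring_1 \<Rightarrow> 'a \<Rightarrow> 'a set" for x y where
  zero: "0 \<in> commuting_span x y"
| add: "commutator x c = 0 \<Longrightarrow> z \<in> commuting_span x y \<Longrightarrow> y ^ k * c + z \<in> commuting_span x y"

lemma commuting_span_add:
  "z \<in> commuting_span x y \<Longrightarrow> z' \<in> commuting_span x y \<Longrightarrow> z + z' \<in> commuting_span x y"
  by (induction rule: commuting_span.induct) (auto simp: add.assoc intro: commuting_span.add)

lemma commuting_span_monomial:
  "commutator x c = 0 \<Longrightarrow> y ^ k * c \<in> commuting_span x y"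
  using commuting_span.add[OF _ commuting_span.zero, of x c y k] by simp

text \<open>As \<open>commutator x y\<close> is 1, the derivation acts on powers of \<open>y\<close>
  like differentiation by \<open>y\<close>.\<close>

lemma commutator_power:
  assumes "commutator x y = 1"
  shows "commutator x (y ^ Suc k) = of_nat (Suc k) * y ^ k"
proof (induction k)
  case (Suc k)
  have "commutator x (y ^ Suc (Suc k)) = y ^ Suc k + y * (of_nat (Suc k) * y ^ k)"
    by (simp only: power_Suc[of y "Suc k"] commutator_mult_right assms Suc mult_1_left)
  also have "y * (of_nat (Suc k) * y ^ k) = of_nat (Suc k) * y ^ Suc k"
    by (metis mult.assoc mult_of_nat_commute power_Suc)
  finally show ?case by (simp add: algebra_simps)
qed (simp add: assms)

text \<open>Integrate termwise in \<open>y\<close>: coefficients commuting with \<open>x\<close>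
  behave as constants. Dividing by \<open>Suc k\<close> is where characteristic 0 enters.\<close>

lemma commuting_span_subset_range:
  fixes scale :: "'f::field_char_0 \<Rightarrow> 'a::ring_1 \<Rightarrow> 'a" and x y :: 'a
  assumes "unital_algebra scale" and xy: "commutator x y = 1"
  shows "commuting_span x y \<subseteq> range (commutator x)"
proof
  interpret unital_algebra scale by fact
  fix z assume "z \<in> commuting_span x y"
  then show "z \<in> range (commutator x)"
  proof induction
    case zero
    then show ?case by (metis commutator_zero_right rangeI)
  next
    case (add c z k)
    then obtain z' where z': "z = commutator x z'" by auto
    \<comment> \<open>Integers of the ring are rewritten as scalars, which can be inverted.\<close>
    have nat: "of_nat n * w = scale (of_nat n) w" for n w
      by (induction n) (simp_all add: distrib_right scale_left_distrib)
    have "commutator x (scale (inverse (of_nat (Suc k))) (y ^ Suc k * c)) = y ^ k * c"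
      unfolding commutator_scale_right commutator_mult_right commutator_power[OF xy] add.hyps(1)
      by (simp add: nat scale_mult_left del: of_nat_Suc)
    then show ?case
      unfolding z' by (metis commutator_add_right rangeI)
  qed
qed

text \<open>The span contains 1 and is stable under scalars, sums and left multiplication by
  generators; each generator is moved past \<open>weyl_q i ^ k\<close> into the coefficient or
  absorbed into the power.\<close>

lemma commuting_span_weyl: "(z :: ('n, 'f::field) weyl) \<in> commuting_span (weyl_p i) (weyl_q i)"
proof (induction z rule: weyl_induct)
  case zero
  show ?case by (rule commuting_span.zero)
next
  case (add y z)
  then show ?case by (rule commuting_span_add)
next
  case (scale c z)
  then show ?case
  proof induction
    case (add c' z k)
    have "weyl_scale c (weyl_q i ^ k * c') = weyl_q i ^ k * weyl_scale c c'"
      by (simp add: weyl.scale_mult_right)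
    then show ?case
      using add by (simp add: weyl.scale_right_distrib commuting_span.add weyl.commutator_scale_right)
  qed (simp add: commuting_span.zero)
next
  case one
  show ?case
    using commuting_span_monomial[of "weyl_p i" 1 "weyl_q i" 0] by (simp add: commutator_one_right)
next
  case (p j z)
  then show ?case
  proof induction
    case (add c z k)
    have pj: "commutator (weyl_p i) (weyl_p j * c) = 0"
      by (simp add: commutator_mult_right weyl_relations add.hyps)
    have "commutator (weyl_p j) (weyl_q i ^ k)
        = (if j = i then of_nat k * weyl_q i ^ (k - 1) else 0 :: ('n, 'f) weyl)"
    proof (cases "j = i")
      case True
      then show ?thesis
        by (cases k) (simp_all add: commutator_one_right commutator_power weyl_relations del: power_Suc of_nat_Suc)
    next
      case False
      then show ?thesis
        by (induction k) (simp_all add: commutator_one_right commutator_mult_right weyl_relations)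
    qed
    then have "weyl_p j * weyl_q i ^ k = weyl_q i ^ k * weyl_p j
        + (if j = i then of_nat k * weyl_q i ^ (k - 1) else 0 :: ('n, 'f) weyl)"
      by (simp add: commutator_def algebra_simps)
    \<comment> \<open>For \<open>k = 0\<close> the exponent \<open>k - 1\<close> is truncated to 0,
      harmlessly, since the factor \<open>of_nat k\<close> is then zero.\<close>
    then have eq: "weyl_p j * (weyl_q i ^ k * c + z) = weyl_q i ^ k * (weyl_p j * c)
        + (weyl_q i ^ (k - 1) * ((if j = i then of_nat k else 0) * c) + weyl_p j * z)"
      by (auto simp: distrib_left mult.assoc[symmetric] distrib_right mult_of_nat_commute)
    have "commutator (weyl_p i) ((if j = i then of_nat k else 0) * c) = 0"
      using add.hyps by (simp add: commutator_mult_right) (simp add: commutator_def mult_of_nat_commute)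
    then show ?case
      unfolding eq using pj add.IH by (intro commuting_span.add) auto
  qed (simp add: commuting_span.zero)
next
  case (q j z)
  then show ?case
  proof induction
    case (add c z k)
    show ?case
    proof (cases "j = i")
      case True
      have "weyl_q j * (weyl_q i ^ k * c + z) = weyl_q i ^ Suc k * c + weyl_q j * z"
        by (simp add: True distrib_left mult.assoc)
      then show ?thesis
        using add by (simp add: commuting_span.add del: power_Suc)
    next
      case False
      \<comment> \<open>For distinct indices \<open>weyl_q j\<close> commutes with both
        \<open>weyl_q i\<close> and \<open>weyl_p i\<close>, so it joins the coefficient.\<close>
      have "weyl_q j * weyl_q i = weyl_q i * (weyl_q j :: ('n, 'f) weyl)"
        using weyl_relations(3)[of j i] by (simp add: commutator_def)
      then have "weyl_q j * weyl_q i ^ k = weyl_q i ^ k * (weyl_q j :: ('n, 'f) weyl)"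
        by (metis power_commuting_commutes)
      then have "weyl_q j * (weyl_q i ^ k * c + z) = weyl_q i ^ k * (weyl_q j * c) + weyl_q j * z"
        by (simp add: distrib_left flip: mult.assoc)
      moreover have "commutator (weyl_p i) (weyl_q j * c) = 0"
        using False by (simp add: commutator_mult_right weyl_relations add.hyps)
      ultimately show ?thesis
        using add by (simp add: commuting_span.add)
    qed
  qed (simp add: commuting_span.zero)
qed

lemma surj_commutator_weyl_p:
  "surj (commutator (weyl_p i :: ('n, 'f::field_char_0) weyl))"
proof -
  have "commuting_span (weyl_p i) (weyl_q i) \<subseteq> range (commutator (weyl_p i :: ('n, 'f) weyl))"
    by (rule commuting_span_subset_range[OF weyl.unital_algebra_axioms]) (simp add: weyl_relations)
  then have "z \<in> range (commutator (weyl_p i))" for z :: "('n, 'f) weyl"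
    using commuting_span_weyl by (rule subsetD)
  then show ?thesis by (rule UNIV_eq_I[symmetric])
qed

theorem corollary1p4:
  fixes f :: "(nat, 'f::field_char_0) free_algebra" and m :: nat
  assumes "m \<ge> 1"
    and "multilinear m f"
    and "f \<noteq> 0"
  shows "poly_image (weyl_scale :: 'f \<Rightarrow> ('n::finite, 'f) weyl \<Rightarrow> ('n, 'f) weyl) f = UNIV"
  \<comment> \<open>Any index \<open>i\<close> serves for \<open>weyl_p i\<close>; one exists
    because types are nonempty.\<close>
  using assms by (rule weyl.multilinear_surjective[OF surj_commutator_weyl_p])

end
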